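(* Let $k\ge 1$. Every $k$-constructible graph $G=(V,E)$ with $n\ge k+1$ vertices satisfies $|E|\le nk-\binom{k+1}{2}$.
   Context: A graph $G=(V,E)$ is called $k$-constructible if there is an ordering $e_1,\dots,e_m$ of $E$ such that for every $i\in\{1,\dots,m\}$ the graph $(V,\{e_1,\dots,e_{i-1}\})$ contains at most $k-1$ internally vertex-disjoint paths between the two endpoints of $e_i$. *)

theory Defs
  imports Main
begin

definition simple_graph :: "'a set \<Rightarrow> 'a set set \<Rightarrow> bool" where
  "simple_graph V E \<longleftrightarrow> finite V \<and> (\<forall>e\<in>E. \<exists>u v. e = {u, v} \<and> u \<noteq> v \<and> u \<in> V \<and> v \<in> V)"

definition is_path :: "'a set set \<Rightarrow> 'a \<Rightarrow> 'a \<Rightarrow> 'a list \<Rightarrow> bool" where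
  "is_path F u v p \<longleftrightarrow> p \<noteq> [] \<and> hd p = u \<and> last p = v \<and> distinct p \<and>
     (\<forall>i. Suc i < length p \<longrightarrow> {p ! i, p ! Suc i} \<in> F)"

definition internal_vertices :: "'a list \<Rightarrow> 'a set" where
  "internal_vertices p = set (butlast (tl p))"

definition disjoint_paths :: "'a set set \<Rightarrow> 'a \<Rightarrow> 'a \<Rightarrow> 'a list set \<Rightarrow> bool" where
  "disjoint_paths F u v P \<longleftrightarrow> (\<forall>p\<in>P. is_path F u v p) \<and>
     (\<forall>p\<in>P. \<forall>q\<in>P. p \<noteq> q \<longrightarrow> internal_vertices p \<inter> internal_vertices q = {})"

definition k_constructible :: "nat \<Rightarrow> 'a set \<Rightarrow> 'a set set \<Rightarrow> bool" where
  "k_constructible k V E \<longleftrightarrow> (\<exists>es. distinct es \<and> set es = E \<and>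
     (\<forall>i < length es. \<forall>u v. es ! i = {u, v} \<longrightarrow>
        (\<forall>P. disjoint_paths (set (take i es)) u v P \<longrightarrow> finite P \<and> card P \<le> k - 1)))"

end

theory Submission
  imports Defs "HOL-Computational_Algebra.Polynomial"
begin

text \<open>By Menger's theorem, each new edge \<open>u v\<close> comes with a set \<open>S\<close> of fewer than \<open>k\<close> vertices
  separating a set \<open>X\<close> containing \<open>u\<close> from \<open>v\<close> in the graph built so far. Place the vertices at
  distinct reals \<open>t x\<close>, let \<open>w\<close> be the polynomial of degree below \<open>k\<close> with root set \<open>t ` S\<close>, and put
  \<open>g x y = w (t x) * w (t y)\<close> for \<open>x \<in> X\<close> and \<open>g x y = 0\<close> otherwise. Then \<open>g x y - g y x\<close> vanishes on
  all earlier edges but not on the new one, so these antisymmetric functions are linearly independent.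
  As \<open>g\<close> is polynomial of degree below \<open>k\<close> in its second argument, a combination of them vanishes
  as soon as it vanishes on the pairs meeting a fixed \<open>k\<close>-set of vertices, and there are
  \<open>(n - k) k + (k choose 2) = n k - (k + 1 choose 2)\<close> such pairs. (In terms of rigidity, the \<open>g\<close> are
  infinitesimal motions in Kalai's hyperconnectivity matroid on the moment curve.)\<close>

section \<open>Menger's theorem\<close>

definition walk :: "'a set set \<Rightarrow> 'a list \<Rightarrow> bool" where
  "walk F p \<longleftrightarrow> p \<noteq> [] \<and> successively (\<lambda>x y. {x, y} \<in> F) p"

text \<open>Quantifying over walks rather than paths lets walks be concatenated without removing
  repeated vertices. One-vertex walks count, so \<open>S\<close> must contain
  \<open>A \<inter> B\<close>.\<close>

definition separates :: "'a set set \<Rightarrow> 'a set \<Rightarrow> 'a set \<Rightarrow> 'a set \<Rightarrow> bool" where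
  "separates F A B S \<longleftrightarrow>
     (\<forall>p. walk F p \<longrightarrow> hd p \<in> A \<longrightarrow> last p \<in> B \<longrightarrow> set p \<inter> S \<noteq> {})"

definition linkage :: "'a set set \<Rightarrow> 'a set \<Rightarrow> 'a set \<Rightarrow> 'a list set \<Rightarrow> bool" where
  "linkage F A B P \<longleftrightarrow>
     (\<forall>p\<in>P. walk F p \<and> distinct p \<and> hd p \<in> A \<and> last p \<in> B) \<and>
     (\<forall>p\<in>P. \<forall>q\<in>P. p \<noteq> q \<longrightarrow> set p \<inter> set q = {})"

lemma walk_rev: "walk F (rev p) \<longleftrightarrow> walk F p"
  unfolding walk_def by (simp add: insert_commute)

lemma walk_append_iff:
  "walk F (p @ q) \<longleftrightarrow>
     (p = [] \<and> walk F q \<or> q = [] \<and> walk F p \<or>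
      walk F p \<and> walk F q \<and> {last p, hd q} \<in> F)"
  unfolding walk_def by (cases "p = []"; cases "q = []") (auto simp: successively_append_iff)

lemma walk_singleton [simp]: "walk F [x]"
  unfolding walk_def by simp

lemma walk_mono: "walk F p \<Longrightarrow> F \<subseteq> G \<Longrightarrow> walk G p"
  unfolding walk_def by (auto elim: successively_mono)

lemma walk_Diff_edge:
  assumes "walk F p" "x \<in> e" "x \<notin> set p"
  shows "walk (F - {e}) p"
proof -
  have "successively (\<lambda>a b. {a, b} \<in> F - {e}) p \<longleftrightarrow> successively (\<lambda>a b. {a, b} \<in> F) p"
    using assms(2,3) by (intro successively_cong) auto
  with assms(1) show ?thesis unfolding walk_def by simp
qed

lemma walk_prefix: "walk F (p @ z # q) \<Longrightarrow> walk F (p @ [z])"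
  by (auto simp: walk_append_iff)

lemma walk_suffix: "walk F (p @ z # q) \<Longrightarrow> walk F (z # q)"
  by (auto simp: walk_append_iff)

lemma walk_join: "walk F (p @ [z]) \<Longrightarrow> walk F (z # q) \<Longrightarrow> walk F (p @ z # q)"
  by (auto simp: walk_append_iff)

lemma separates_sym: "separates F A B S \<longleftrightarrow> separates F B A S"
proof -
  have "separates F B A S" if "separates F A B S" for A B
    unfolding separates_def
  proof (intro allI impI)
    fix p assume p: "walk F p" "hd p \<in> B" "last p \<in> A"
    then have "p \<noteq> []" by (simp add: walk_def)
    then have "set (rev p) \<inter> S \<noteq> {}"
      using that p unfolding separates_def by (metis walk_rev hd_rev last_rev)
    then show "set p \<inter> S \<noteq> {}" by simp
  qed
  then show ?thesis by blast
qed

text \<open>Otherwise a walk from \<open>A\<close> to \<open>z\<close> and one from \<open>z\<close>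
  to \<open>B\<close>, both avoiding \<open>S\<close>, join at \<open>z\<close>. This assigns each
  end of a deleted edge to a side of \<open>S\<close>.\<close>

lemma separates_cut_vertex:
  assumes "separates F A B S"
  shows "separates F A {z} S \<or> separates F {z} B S"
proof (rule ccontr)
  assume "\<not> ?thesis"
  then obtain p q where p: "walk F p" "hd p \<in> A" "last p = z" "set p \<inter> S = {}"
    and q: "walk F q" "hd q = z" "last q \<in> B" "set q \<inter> S = {}"
    unfolding separates_def by auto
  obtain p' where p': "p = p' @ [z]"
    using p(1,3) unfolding walk_def by (metis append_butlast_last_id)
  obtain q' where q': "q = z # q'"
    using q(1,2) unfolding walk_def by (metis list.collapse)
  have "walk F (p' @ z # q')" using p(1) q(1) p' q' walk_join by auto
  moreover have "hd (p' @ z # q') \<in> A" using p(2) p' by (cases p') auto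
  moreover have "last (p' @ z # q') \<in> B" using q(3) q' by simp
  moreover have "set (p' @ z # q') \<inter> S = {}" using p(4) q(4) p' q' by auto
  ultimately show False using assms unfolding separates_def by blast
qed

text \<open>Cut a walk at its first vertex in \<open>insert x S\<close>. The part before it misses
  \<open>x\<close>, and it cannot enter \<open>x\<close> along the restored edge, since
  \<open>y\<close> is unreachable from \<open>A\<close> without meeting \<open>S\<close>. So this
  initial walk survives the deletion and meets \<open>T\<close>. Hence separators in the smaller
  graph inherit the lower bound \<open>k\<close>.\<close>

lemma separates_restore_edge:
  assumes AB: "separates (F - {{x, y}}) A B S"
    and Ay: "separates (F - {{x, y}}) A {y} S"
    and T: "separates (F - {{x, y}}) A (insert x S) T"
  shows "separates F A B T"
  unfolding separates_def
proof (intro allI impI)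
  fix p assume p: "walk F p" "hd p \<in> A" "last p \<in> B"
  let ?G = "F - {{x, y}}"
  show "set p \<inter> T \<noteq> {}"
  proof (cases "\<exists>z\<in>set p. z \<in> insert x S")
    case True
    then obtain p1 z p2 where p12: "p = p1 @ z # p2" and z: "z \<in> insert x S"
      and p1: "\<forall>w\<in>set p1. w \<notin> insert x S"
      by (auto dest!: split_list_first_prop)
    have w: "walk F (p1 @ [z])" using p(1) p12 walk_prefix by auto
    have "walk ?G (p1 @ [z])"
    proof (cases "p1 = []")
      case False
      then have 1: "walk F p1" and 2: "{last p1, z} \<in> F"
        using w by (auto simp: walk_append_iff)
      have 3: "walk ?G p1" using walk_Diff_edge[OF 1, of x "{x, y}"] p1 by auto
      have "{last p1, z} \<noteq> {x, y}"
      proof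
        assume "{last p1, z} = {x, y}"
        then have "last p1 = y" using p1 last_in_set[OF False] by (auto simp: doubleton_eq_iff)
        moreover have "hd p1 \<in> A" using p(2) p12 False by simp
        ultimately have "set p1 \<inter> S \<noteq> {}" using Ay 3 unfolding separates_def by simp
        with p1 show False by auto
      qed
      with 2 3 show ?thesis by (simp add: walk_append_iff)
    qed simp
    moreover have "hd (p1 @ [z]) \<in> A" using p(2) p12 by (cases p1) auto
    ultimately have "set (p1 @ [z]) \<inter> T \<noteq> {}"
      using T z unfolding separates_def by (metis last_snoc)
    then show ?thesis using p12 by auto
  next
    case False
    then have "walk ?G p" using walk_Diff_edge[OF p(1), of x "{x, y}"] by auto
    then have "set p \<inter> S \<noteq> {}" using AB p unfolding separates_def by blast
    with False show ?thesis by auto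
  qed
qed

lemma separates_endpoint: "A \<subseteq> S \<Longrightarrow> separates F A B S"
  unfolding separates_def walk_def using hd_in_set by fastforce

lemma separates_insert: "separates F A {x} S \<Longrightarrow> separates F A (insert x S) S"
  unfolding separates_def walk_def using last_in_set by fastforce

lemma linkage_mono: "linkage F A B P \<Longrightarrow> F \<subseteq> G \<Longrightarrow> linkage G A B P"
  unfolding linkage_def using walk_mono by blast

lemma linkage_rev:
  assumes "linkage F A B P"
  shows "linkage F B A (rev ` P)" "card (rev ` P) = card P"
proof -
  show "linkage F B A (rev ` P)"
    using assms unfolding linkage_def
    by (auto simp: walk_rev hd_rev last_rev)
  show "card (rev ` P) = card P" by (intro card_image inj_onI) simp
qed

section \<open>Gluing linkages along a separator\<close>

text \<open>Disjoint paths have distinct last vertices, so with \<open>card P = card C\<close> these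
  exhaust \<open>C\<close>. Every vertex of \<open>C\<close> is then the end of its own path and
  lies on no other.\<close>

lemma linkage_by_last:
  assumes P: "linkage F A C P" and C: "finite C" "card P = card C"
  obtains p where "\<And>c. c \<in> C \<Longrightarrow> walk F (p c) \<and> distinct (p c) \<and> hd (p c) \<in> A \<and> last (p c) = c"
    and "\<And>c. c \<in> C \<Longrightarrow> set (p c) \<inter> C = {c}"
    and "\<And>c d. c \<in> C \<Longrightarrow> d \<in> C \<Longrightarrow> c \<noteq> d \<Longrightarrow> set (p c) \<inter> set (p d) = {}"
proof -
  have ne: "p \<noteq> []" if "p \<in> P" for p using P that unfolding linkage_def walk_def by blast
  have "inj_on last P"
  proof (rule inj_onI)
    fix p q assume pq: "p \<in> P" "q \<in> P" "last p = last q"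
    then have "last p \<in> set p \<inter> set q" using ne by (metis IntI last_in_set)
    then show "p = q" using P pq(1,2) unfolding linkage_def by blast
  qed
  moreover have "last ` P \<subseteq> C" using P unfolding linkage_def by auto
  ultimately have im: "last ` P = C" using C by (metis card_image card_subset_eq)
  define p where "p = inv_into P last"
  have p: "p c \<in> P" "last (p c) = c" if "c \<in> C" for c
    using that unfolding p_def im[symmetric] by (rule inv_into_into, rule f_inv_into_f)
  have disj: "set (p c) \<inter> set (p d) = {}" if "c \<in> C" "d \<in> C" "c \<noteq> d" for c d
    using P p that unfolding linkage_def by metis
  have mem: "c \<in> set (p c)" if "c \<in> C" for c using p[OF that] ne last_in_set by metis
  show ?thesis
  proof (rule that[of p])
    show "walk F (p c) \<and> distinct (p c) \<and> hd (p c) \<in> A \<and> last (p c) = c" if "c \<in> C" for c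
      using P p that unfolding linkage_def by blast
    show "set (p c) \<inter> C = {c}" if "c \<in> C" for c
      using disj mem that by blast
  qed (use disj in blast)
qed

lemma linkage_by_hd:
  assumes P: "linkage F C B P" and C: "finite C" "card P = card C"
  obtains p where "\<And>c. c \<in> C \<Longrightarrow> walk F (p c) \<and> distinct (p c) \<and> hd (p c) = c \<and> last (p c) \<in> B"
    and "\<And>c. c \<in> C \<Longrightarrow> set (p c) \<inter> C = {c}"
    and "\<And>c d. c \<in> C \<Longrightarrow> d \<in> C \<Longrightarrow> c \<noteq> d \<Longrightarrow> set (p c) \<inter> set (p d) = {}"
proof -
  obtain p where p: "\<And>c. c \<in> C \<Longrightarrow> walk F (p c) \<and> distinct (p c) \<and> hd (p c) \<in> B \<and> last (p c) = c"
    "\<And>c. c \<in> C \<Longrightarrow> set (p c) \<inter> C = {c}"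
    "\<And>c d. c \<in> C \<Longrightarrow> d \<in> C \<Longrightarrow> c \<noteq> d \<Longrightarrow> set (p c) \<inter> set (p d) = {}"
    using linkage_by_last[OF linkage_rev(1)[OF P] C(1)] linkage_rev(2)[OF P] C(2) by metis
  show ?thesis
    by (rule that[of "\<lambda>c. rev (p c)"])
      (use p in \<open>auto simp: walk_rev hd_rev last_rev\<close>)
qed

text \<open>Switching from \<open>p\<close> to \<open>q\<close> at \<open>z\<close> yields a walk
  from \<open>A\<close> to \<open>B\<close>. It can meet \<open>S\<close> only at \<open>z\<close>,
  because \<open>p\<close> may meet \<open>S\<close> only at its end and \<open>q\<close> only at
  its start.\<close>

lemma linkages_meet_in_separator:
  assumes S: "separates F A B S"
    and p: "walk F p" "distinct p" "hd p \<in> A" "set p \<inter> S \<subseteq> {last p}"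
    and q: "walk F q" "distinct q" "last q \<in> B" "set q \<inter> S \<subseteq> {hd q}"
    and z: "z \<in> set p" "z \<in> set q"
  shows "z \<in> S"
proof (rule ccontr)
  assume "z \<notin> S"
  obtain a b where ab: "p = a @ z # b" using z(1) split_list by metis
  obtain c d where cd: "q = c @ z # d" using z(2) split_list by metis
  have "walk F (a @ z # d)"
    using p(1) q(1) ab cd walk_prefix walk_suffix walk_join by metis
  moreover have "hd (a @ z # d) \<in> A" using p(3) ab by (cases a) auto
  moreover have "last (a @ z # d) \<in> B" using q(3) cd by simp
  ultimately have "set (a @ z # d) \<inter> S \<noteq> {}" using S unfolding separates_def by blast
  then obtain w where w: "w \<in> S" "w \<in> set a \<or> w \<in> set d" using \<open>z \<notin> S\<close> by auto
  from w(2) show False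
  proof
    assume "w \<in> set a"
    then have "w = last (z # b)" using p(4) w(1) ab by auto
    then have "w \<in> set (z # b)" using last_in_set by blast
    then show False using p(2) ab \<open>w \<in> set a\<close> by auto
  next
    assume "w \<in> set d"
    then have "w = hd (c @ [z])" using q(4) w(1) cd by (cases c) auto
    then have "w \<in> set (c @ [z])" using hd_in_set by blast
    then show False using q(2) cd \<open>w \<in> set d\<close> by auto
  qed
qed

text \<open>Goering's induction on the edges: if some \<open>S\<close> with \<open>card S < k\<close> separates \<open>A\<close> from \<open>B\<close> once \<open>e = {x, y}\<close>
  is removed, paths from \<open>A\<close> to \<open>insert x S\<close> and from \<open>insert y S\<close> to \<open>B\<close> are glued along \<open>S\<close> and \<open>e\<close>.\<close>

theorem menger_sets:
  assumes "finite F" "\<And>e. e \<in> F \<Longrightarrow> \<exists>x y. e = {x, y}" "finite A"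
    and "\<And>S. finite S \<Longrightarrow> separates F A B S \<Longrightarrow> k \<le> card S"
  shows "\<exists>P. linkage F A B P \<and> card P = k"
  using assms
proof (induction F arbitrary: A B rule: finite_induct)
  case empty
  \<comment> \<open>Without edges every walk is a single vertex, so \<open>A \<inter> B\<close>
    separates and its elements serve as trivial paths.\<close>
  have "separates {} A B (A \<inter> B)"
    unfolding separates_def walk_def
  proof (intro allI impI)
    fix p :: "'a list"
    assume p: "p \<noteq> [] \<and> successively (\<lambda>x y. {x, y} \<in> {}) p" "hd p \<in> A" "last p \<in> B"
    obtain x where "p = [x]" using p(1) by (cases p rule: list.exhaust; cases "tl p") auto
    then show "set p \<inter> (A \<inter> B) \<noteq> {}" using p by auto
  qed
  then have "k \<le> card (A \<inter> B)" using empty by auto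
  then obtain C where C: "C \<subseteq> A \<inter> B" "card C = k" by (metis obtain_subset_with_card_n)
  have "linkage {} A B ((\<lambda>x. [x]) ` C)" using C(1) unfolding linkage_def by auto
  moreover have "card ((\<lambda>x. [x]) ` C) = k" using C(2) by (subst card_image) (auto intro: inj_onI)
  ultimately show ?case by blast
next
  case (insert e F)
  show ?case
  proof (cases "\<forall>S. finite S \<longrightarrow> separates F A B S \<longrightarrow> k \<le> card S")
    case True
    then show ?thesis using insert.IH[of A B] insert.prems linkage_mono[of F A B]
      by (metis insertI2 subset_insertI)
  next
    case False
    then obtain S where S: "finite S" "separates F A B S" "card S < k" by auto
    have nS: "\<not> separates (insert e F) A B S" using insert.prems(3)[OF S(1)] S(3) by auto
    have del: "insert e F - {e} = F" using insert.hyps by simp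
    have fwd: "separates (insert e F) A B T"
      if "e = {x, y}" "separates F A {y} S" "separates F A (insert x S) T" for x y T
      using separates_restore_edge[of "insert e F" x y A B S T] that S(2) del by simp
    have bwd: "separates (insert e F) A B T"
      if "e = {x, y}" "separates F {x} B S" "separates F (insert y S) B T" for x y T
    proof -
      have e': "{y, x} = e" using that(1) by auto
      have "separates (insert e F) B A T"
        using separates_restore_edge[of "insert e F" y x B A S T] that(2,3) S(2)
        unfolding e' del by (metis separates_sym)
      then show ?thesis by (metis separates_sym)
    qed
    \<comment> \<open>This orients \<open>e\<close>. Each end is cut off by \<open>S\<close> from
      \<open>A\<close> or from \<open>B\<close>; if both were cut off from the same side,
      \<open>S\<close> would still separate after \<open>e\<close> is restored, contradicting
      \<open>nS\<close>.\<close>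
    have "\<exists>x y. e = {x, y} \<and> separates F A {y} S \<and> separates F {x} B S"
    proof -
      obtain x y where e: "e = {x, y}" using insert.prems(1) by blast
      then have e': "e = {y, x}" by auto
      have "\<not> (separates F A {x} S \<and> separates F A {y} S)"
        using fwd[OF e, of S] separates_insert[of F A x S] nS by auto
      moreover have "\<not> (separates F {x} B S \<and> separates F {y} B S)"
      proof
        assume "separates F {x} B S \<and> separates F {y} B S"
        then have "separates F (insert y S) B S"
          using separates_insert[of F B y S] by (simp add: separates_sym[of F B])
        then show False using bwd[OF e, of S] nS \<open>separates F {x} B S \<and> _\<close> by auto
      qed
      ultimately show ?thesis
        using separates_cut_vertex[OF S(2), of x] separates_cut_vertex[OF S(2), of y] e e' by metis
    qed
    then obtain x y where e: "e = {x, y}" and Ay: "separates F A {y} S" and xB: "separates F {x} B S"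
      by blast
    have sx: "k \<le> card T" if "finite T" "separates F A (insert x S) T" for T
      by (rule insert.prems(3)[OF that(1) fwd[OF e Ay that(2)]])
    have sy: "k \<le> card T" if "finite T" "separates F (insert y S) B T" for T
      by (rule insert.prems(3)[OF that(1) bwd[OF e xB that(2)]])
    \<comment> \<open>The target set \<open>insert x S\<close> separates \<open>A\<close> from
      itself, so it has at least \<open>k\<close> elements; with \<open>card S < k\<close> this
      forces \<open>x \<notin> S\<close> and size exactly \<open>k\<close>.\<close>
    have "k \<le> card (insert x S)"
      using sx[of "insert x S"] S(1) separates_endpoint[of "insert x S" "insert x S" F A]
      by (simp add: separates_sym[of F A])
    then have x: "x \<notin> S" and cx: "card (insert x S) = k"
      using S(1,3) by (auto simp: card_insert_if split: if_splits)
    have "k \<le> card (insert y S)"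
      using sy[of "insert y S"] S(1) separates_endpoint[of "insert y S" "insert y S" F B] by simp
    then have y: "y \<notin> S" and cy: "card (insert y S) = k"
      using S(1,3) by (auto simp: card_insert_if split: if_splits)
    obtain P where P: "linkage F A (insert x S) P" "card P = card (insert x S)"
      using insert.IH[of A "insert x S"] insert.prems(1,2) sx cx by auto
    obtain Q where Q: "linkage F (insert y S) B Q" "card Q = card (insert y S)"
      using insert.IH[of "insert y S" B] insert.prems(1) sy cy S(1) by auto
    obtain p where p: "\<And>c. c \<in> insert x S \<Longrightarrow> walk F (p c) \<and> distinct (p c) \<and> hd (p c) \<in> A \<and> last (p c) = c"
      and pS: "\<And>c. c \<in> insert x S \<Longrightarrow> set (p c) \<inter> insert x S = {c}"
      and pd: "\<And>c d. c \<in> insert x S \<Longrightarrow> d \<in> insert x S \<Longrightarrow> c \<noteq> d \<Longrightarrow> set (p c) \<inter> set (p d) = {}"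
      using linkage_by_last[OF P(1) _ P(2)] S(1) by (metis finite_insert)
    obtain q where q: "\<And>c. c \<in> insert y S \<Longrightarrow> walk F (q c) \<and> distinct (q c) \<and> hd (q c) = c \<and> last (q c) \<in> B"
      and qS: "\<And>c. c \<in> insert y S \<Longrightarrow> set (q c) \<inter> insert y S = {c}"
      and qd: "\<And>c d. c \<in> insert y S \<Longrightarrow> d \<in> insert y S \<Longrightarrow> c \<noteq> d \<Longrightarrow> set (q c) \<inter> set (q d) = {}"
      using linkage_by_hd[OF Q(1) _ Q(2)] S(1) by (metis finite_insert)
    have meet: "z \<in> S \<and> z = s \<and> z = t"
      if "s \<in> insert x S" "t \<in> insert y S" "z \<in> set (p s)" "z \<in> set (q t)" for s t z
    proof -
      have "z \<in> S"
        by (rule linkages_meet_in_separator[OF S(2), of "p s" "q t"])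
          (use p[OF that(1)] pS[OF that(1)] q[OF that(2)] qS[OF that(2)] that in auto)
      then show ?thesis using pS[OF that(1)] qS[OF that(2)] that by blast
    qed
    \<comment> \<open>The path ending at \<open>x\<close> crosses \<open>e\<close> and continues
      from \<open>y\<close>; a path ending in \<open>S\<close> continues from that same vertex,
      which \<open>q'\<close> drops to avoid repeating it.\<close>
    define \<sigma> where "\<sigma> c = (if c = x then y else c)" for c
    define q' where "q' c = (if c = x then q y else tl (q c))" for c
    define r where "r c = p c @ q' c" for c
    have \<sigma>: "\<sigma> c \<in> insert y S" if "c \<in> insert x S" for c using that unfolding \<sigma>_def by auto
    have \<sigma>_inj: "\<sigma> c \<noteq> \<sigma> d" if "c \<in> insert x S" "d \<in> insert x S" "c \<noteq> d" for c d
      using that y unfolding \<sigma>_def by auto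
    have q'sub: "set (q' c) \<subseteq> set (q (\<sigma> c))" for c
      unfolding q'_def \<sigma>_def by (cases "q c") auto
    have pq: "set (p s) \<inter> set (q' t) = {}" if st: "s \<in> insert x S" "t \<in> insert x S" for s t
    proof (rule ccontr)
      assume "\<not> ?thesis"
      then obtain z where z: "z \<in> set (p s)" "z \<in> set (q' t)" by blast
      have zt: "z \<in> S" "z = \<sigma> t" using meet[OF st(1) \<sigma>[OF st(2)] z(1)] z(2) q'sub by blast+
      then have tx: "t \<noteq> x" using y unfolding \<sigma>_def by auto
      then have "z = t" "t \<in> insert y S" using zt unfolding \<sigma>_def by auto
      then have "hd (q t) = z" "distinct (q t)" using q by auto
      moreover have "z \<in> set (tl (q t))" using z(2) tx unfolding q'_def by simp
      ultimately show False by (cases "q t") auto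
    qed
    have r: "walk (insert e F) (r c) \<and> distinct (r c) \<and> hd (r c) \<in> A \<and> last (r c) \<in> B"
      if c: "c \<in> insert x S" for c
    proof (intro conjI)
      have pc: "walk F (p c)" "distinct (p c)" "hd (p c) \<in> A" "last (p c) = c"
        using p[OF c] by auto
      then have ne: "p c \<noteq> []" by (simp add: walk_def)
      have qc: "walk F (q (\<sigma> c))" "distinct (q (\<sigma> c))" "hd (q (\<sigma> c)) = \<sigma> c" "last (q (\<sigma> c)) \<in> B"
        using q[OF \<sigma>[OF c]] by auto
      show "hd (r c) \<in> A" using pc ne unfolding r_def by simp
      have "distinct (q' c)" using qc(2) unfolding q'_def \<sigma>_def by (auto simp: distinct_tl)
      then show "distinct (r c)" using pc(2) pq[OF c c] unfolding r_def by simp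
      have "walk (insert e F) (r c) \<and> last (r c) \<in> B"
      proof (cases "c = x")
        case True
        have "walk (insert e F) (p x)" "walk (insert e F) (q y)"
          using pc(1) qc(1) True walk_mono[of F _ "insert e F"] unfolding \<sigma>_def by auto
        moreover have "{last (p x), hd (q y)} \<in> insert e F"
          using pc(4) qc(3) True e unfolding \<sigma>_def by simp
        moreover have "q y \<noteq> []" using qc(1) True unfolding \<sigma>_def walk_def by simp
        ultimately show ?thesis using qc(4) True
          unfolding r_def q'_def \<sigma>_def by (simp add: walk_append_iff)
      next
        case False
        then have qq: "walk F (q c)" "hd (q c) = c" "last (q c) \<in> B" using qc unfolding \<sigma>_def by auto
        obtain q1 where q1: "q c = c # q1" using qq(1,2) unfolding walk_def by (metis list.collapse)
        obtain p1 where p1: "p c = p1 @ [c]" using pc(4) ne by (metis append_butlast_last_id)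
        have rc: "r c = p1 @ c # q1" unfolding r_def q'_def using False q1 p1 by simp
        have "walk F (r c)" using pc(1) qq(1) unfolding rc q1 p1 by (rule walk_join)
        moreover have "last (r c) \<in> B" using qq(3) unfolding rc q1 by simp
        ultimately show ?thesis using walk_mono[of F _ "insert e F"] by auto
      qed
      then show "walk (insert e F) (r c)" "last (r c) \<in> B" by auto
    qed
    have rd: "set (r c) \<inter> set (r d) = {}" if cd: "c \<in> insert x S" "d \<in> insert x S" "c \<noteq> d" for c d
    proof -
      have "set (q' c) \<inter> set (q' d) = {}"
        using qd[OF \<sigma> \<sigma> \<sigma>_inj, OF cd(1,2) cd] q'sub by blast
      then show ?thesis using pd[OF cd] pq[OF cd(1,2)] pq[OF cd(2,1)] unfolding r_def by auto
    qed
    have "linkage (insert e F) A B (r ` insert x S)"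
      unfolding linkage_def using r rd by blast
    moreover have "inj_on r (insert x S)"
    proof (rule inj_onI, rule ccontr)
      fix c d assume cd: "c \<in> insert x S" "d \<in> insert x S" "r c = r d" "c \<noteq> d"
      then show False using rd[of c d] r[of c] unfolding walk_def by simp
    qed
    then have "card (r ` insert x S) = k" using cx card_image by metis
    ultimately show ?thesis by blast
  qed
qed

section \<open>Vertex cuts for nonadjacent pairs\<close>

text \<open>The set version of Menger's theorem is applied to the neighbourhoods of \<open>u\<close>
  and \<open>v\<close> after all edges at \<open>u\<close> and \<open>v\<close> are deleted.
  \<open>X\<close> is the part reachable from \<open>u\<close> without meeting the separator, so
  edges leaving \<open>X\<close> end in \<open>S\<close>.\<close>

lemma small_vertex_cut:
  assumes F: "finite F" "\<And>e. e \<in> F \<Longrightarrow> \<exists>x y. e = {x, y} \<and> x \<noteq> y"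
    and uv: "u \<noteq> v" "{u, v} \<notin> F"
    and k: "\<And>P. disjoint_paths F u v P \<Longrightarrow> card P \<noteq> k"
  obtains X S where "finite S" "card S < k" "u \<in> X" "v \<notin> X" "u \<notin> S" "v \<notin> S"
    "\<And>x y. {x, y} \<in> F \<Longrightarrow> x \<in> X \<Longrightarrow> y \<in> X \<union> S"
proof -
  define G where "G = {e \<in> F. u \<notin> e \<and> v \<notin> e}"
  define A where "A = {x. {u, x} \<in> F}"
  define B where "B = {x. {x, v} \<in> F}"
  have finG: "finite G" using F(1) unfolding G_def by auto
  have dbl: "\<exists>x y. e = {x, y}" if "e \<in> G" for e using F(2) that unfolding G_def by blast
  have "A \<subseteq> \<Union>F" unfolding A_def by blast
  moreover have "finite (\<Union>F)" using F by (metis finite.simps finite_Union)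
  ultimately have finA: "finite A" by (rule finite_subset)
  have noloop: "{z} \<notin> F" for z using F(2)[of "{z}"] by auto
  have uA: "u \<notin> A" "v \<notin> A" using noloop uv(2) unfolding A_def by auto
  \<comment> \<open>In \<open>G\<close> both \<open>u\<close> and \<open>v\<close> are isolated, and
    neither lies in \<open>A\<close> because \<open>u\<close> and \<open>v\<close> are nonadjacent
    and there are no loops.\<close>
  have walk_avoids: "u \<notin> set p \<and> v \<notin> set p" if "walk G p" "hd p \<in> A" for p
    using that
  proof (induction p rule: rev_induct)
    case (snoc x p)
    show ?case
    proof (cases "p = []")
      case True
      then show ?thesis using snoc.prems uA by auto
    next
      case False
      then have "walk G p" "{last p, x} \<in> G" using snoc.prems(1) by (auto simp: walk_append_iff)
      moreover have "hd p \<in> A" using snoc.prems(2) False by simp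
      ultimately show ?thesis using snoc.IH unfolding G_def by auto
    qed
  qed simp
  have "\<not> (\<forall>S. finite S \<longrightarrow> separates G A B S \<longrightarrow> k \<le> card S)"
  proof
    assume "\<forall>S. finite S \<longrightarrow> separates G A B S \<longrightarrow> k \<le> card S"
    then obtain P where P: "linkage G A B P" "card P = k"
      using menger_sets[OF finG dbl finA, of B k] by blast
    let ?f = "\<lambda>p. u # p @ [v]"
    have "is_path F u v (?f p)" if "p \<in> P" for p
    proof -
      have p: "walk G p" "distinct p" "hd p \<in> A" "last p \<in> B"
        using P(1) that unfolding linkage_def by auto
      have "walk F p" using p(1) walk_mono unfolding G_def by blast
      moreover have "p \<noteq> []" using p(1) unfolding walk_def by simp
      ultimately have "walk F ([u] @ p @ [v])"
        using p(3,4) unfolding A_def B_def by (simp add: walk_append_iff del: append.simps)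
      then have "\<forall>i. Suc i < length (?f p) \<longrightarrow> {?f p ! i, ?f p ! Suc i} \<in> F"
        unfolding walk_def successively_conv_nth by simp
      then show ?thesis using p(2) walk_avoids[OF p(1,3)] uv(1) unfolding is_path_def by auto
    qed
    moreover have "internal_vertices (?f p) = set p" for p
      unfolding internal_vertices_def by simp
    ultimately have "disjoint_paths F u v (?f ` P)"
      using P(1) unfolding disjoint_paths_def linkage_def by auto
    moreover have "card (?f ` P) = k" using P(2) by (subst card_image) (auto intro: inj_onI)
    ultimately show False using k by blast
  qed
  then obtain S where S: "finite S" "separates G A B S" "card S < k" by auto
  define X where "X = insert u {x. \<exists>p. walk G p \<and> hd p \<in> A \<and> last p = x \<and> set p \<inter> S = {}}"
  show ?thesis
  \<comment> \<open>The separator may contain \<open>u\<close> or \<open>v\<close>; dropping them is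
    harmless, as no walk of \<open>G\<close> starting in \<open>A\<close> visits either.\<close>
  proof (rule that[of "S - {u, v}" X])
    show "finite (S - {u, v})" "u \<in> X" "u \<notin> S - {u, v}" "v \<notin> S - {u, v}"
      using S(1) unfolding X_def by auto
    show "card (S - {u, v}) < k" using S(1,3) card_mono[of S "S - {u, v}"] by auto
    show "v \<notin> X"
    proof
      assume "v \<in> X"
      then obtain p where p: "walk G p" "hd p \<in> A" "last p = v" using uv(1) unfolding X_def by auto
      then have "v \<in> set p" unfolding walk_def using last_in_set by blast
      then show False using walk_avoids[OF p(1,2)] by blast
    qed
    show "y \<in> X \<union> (S - {u, v})" if xy: "{x, y} \<in> F" "x \<in> X" for x y
    proof (cases "y = u \<or> y \<in> S - {u, v}")
      case True
      then show ?thesis unfolding X_def by auto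
    next
      case nu: False
      show ?thesis
      proof (cases "x = u")
        case True
        then have yA: "y \<in> A" using xy unfolding A_def by simp
        then have "y \<notin> S" using nu uA by auto
        then have "y \<in> X" unfolding X_def using yA by (intro insertI2 CollectI exI[of _ "[y]"]) simp
        then show ?thesis by simp
      next
        case False
        then obtain p where p: "walk G p" "hd p \<in> A" "last p = x" "set p \<inter> S = {}"
          using xy(2) unfolding X_def by auto
        have ne: "p \<noteq> []" using p(1) by (simp add: walk_def)
        \<comment> \<open>Otherwise \<open>x\<close> would lie in \<open>B\<close>, and
          \<open>p\<close> would lead from \<open>A\<close> to \<open>B\<close> while avoiding
          \<open>S\<close>.\<close>
        have yv: "y \<noteq> v"
          using S(2) p xy(1) unfolding separates_def B_def by auto
        have "x \<noteq> v" using walk_avoids[OF p(1,2)] p(3) ne last_in_set by metis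
        then have "{x, y} \<in> G" using xy(1) False nu yv unfolding G_def by auto
        then have "walk G (p @ [y])" using p(1,3) by (simp add: walk_append_iff)
        moreover have "set (p @ [y]) \<inter> S = {}" using p(4) nu yv by auto
        moreover have "hd (p @ [y]) \<in> A" using p(2) ne by simp
        ultimately have "y \<in> X" unfolding X_def by (intro insertI2 CollectI exI[of _ "p @ [y]"]) simp
        then show ?thesis by simp
      qed
    qed
  qed
qed

section \<open>The rank bound\<close>

text \<open>Gaussian elimination: the unknowns are the \<open>c i\<close>, the equations are indexed
  by \<open>J\<close>, and each induction step removes one equation together with one pivot
  unknown.\<close>

lemma homogeneous_system_nontrivial:
  fixes a :: "'i \<Rightarrow> 'j \<Rightarrow> 'f :: field"
  assumes "finite J" "finite I" "card J < card I"
  shows "\<exists>c. (\<exists>i\<in>I. c i \<noteq> 0) \<and> (\<forall>j\<in>J. (\<Sum>i\<in>I. c i * a i j) = 0)"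
  using assms
proof (induction J arbitrary: I a rule: finite_induct)
  case empty
  then obtain i where "i \<in> I" by fastforce
  then show ?case by (intro exI[of _ "\<lambda>_. 1"]) auto
next
  case (insert j J)
  show ?case
  proof (cases "\<forall>i\<in>I. a i j = 0")
    case True
    then show ?thesis using insert.IH[of I a] insert.prems insert.hyps by auto
  next
    case False
    then obtain i0 where i0: "i0 \<in> I" "a i0 j \<noteq> 0" by blast
    \<comment> \<open>Subtracting multiples of row \<open>i0\<close> clears column \<open>j\<close>;
      in \<open>d\<close> the coefficient \<open>- s\<close> of \<open>i0\<close> collects these
      multiples.\<close>
    define a' where "a' i l = a i l - a i j / a i0 j * a i0 l" for i l
    have "card J < card (I - {i0})" using insert.prems insert.hyps i0 by simp
    then obtain c where c: "\<exists>i\<in>I - {i0}. c i \<noteq> 0" "\<forall>l\<in>J. (\<Sum>i\<in>I - {i0}. c i * a' i l) = 0"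
      using insert.IH[of "I - {i0}" a'] insert.prems by auto
    define s where "s = (\<Sum>i\<in>I - {i0}. c i * a i j / a i0 j)"
    define d where "d = c(i0 := - s)"
    have sum_d: "(\<Sum>i\<in>I. d i * a i l) = (\<Sum>i\<in>I - {i0}. c i * a' i l)" for l
    proof -
      have "(\<Sum>i\<in>I. d i * a i l) = - s * a i0 l + (\<Sum>i\<in>I - {i0}. c i * a i l)"
        using insert.prems(1) i0(1) by (subst sum.remove[of _ i0]) (auto simp: d_def intro!: sum.cong)
      also have "\<dots> = (\<Sum>i\<in>I - {i0}. c i * a' i l)"
        unfolding s_def a'_def by (simp add: right_diff_distrib sum_subtractf sum_distrib_right mult.assoc)
      finally show ?thesis .
    qed
    have "a' i j = 0" for i using i0(2) unfolding a'_def by simp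
    then have "\<forall>l\<in>insert j J. (\<Sum>i\<in>I. d i * a i l) = 0" using c(2) sum_d by simp
    moreover have "\<exists>i\<in>I. d i \<noteq> 0" using c(1) unfolding d_def by auto
    ultimately show ?thesis by blast
  qed
qed

lemma lagrange_interpolation:
  fixes B :: "'f :: field set"
  assumes B: "finite B"
  obtains L :: "'f \<Rightarrow> 'f poly"
  where "\<And>p y. degree p < card B \<Longrightarrow> poly p y = (\<Sum>b\<in>B. poly p b * poly (L b) y)"
proof -
  define L where "L b = smult (inverse (\<Prod>c\<in>B - {b}. b - c)) (\<Prod>c\<in>B - {b}. [:-c, 1:])" for b
  have val: "poly (L b) c = (if b = c then 1 else 0)" if "b \<in> B" "c \<in> B" for b c
    using that B by (auto simp: L_def poly_prod)
  have deg: "degree (L b) \<le> card B - 1" if "b \<in> B" for b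
  proof -
    have "degree (L b) \<le> degree (\<Prod>c\<in>B - {b}. [:-c, 1:])"
      unfolding L_def by (rule degree_smult_le)
    also have "\<dots> \<le> (\<Sum>c\<in>B - {b}. degree [:-c, 1:])" 
      using degree_prod_sum_le[of "B - {b}" "\<lambda>c. [:-c, 1:]"] B by (simp add: o_def)
    also have "\<dots> = card B - 1" using B that by simp
    finally show ?thesis .
  qed
  show ?thesis
  proof (rule that[of L])
    fix p :: "'f poly" and y assume p: "degree p < card B"
    define r where "r = (\<Sum>b\<in>B. smult (poly p b) (L b))"
    have "degree r \<le> card B - 1"
      unfolding r_def using deg by (intro degree_sum_le B) (meson degree_smult_le le_trans)
    \<comment> \<open>The bound on \<open>degree p\<close> makes \<open>card B\<close> positive, so
      \<open>card B - 1\<close> is strictly smaller.\<close>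
    then have dr: "degree r < card B" using p by linarith
    have "poly r c = poly p c" if c: "c \<in> B" for c
    proof -
      have "poly r c = (\<Sum>b\<in>B. if b = c then poly p b else 0)"
        unfolding r_def poly_sum using val c by (intro sum.cong) auto
      also have "\<dots> = poly p c" using B c by simp
      finally show ?thesis .
    qed
    then have "r = p" using dr p by (intro poly_eqI_degree[of B]) auto
    then have "poly p y = poly r y" by simp
    also have "\<dots> = (\<Sum>b\<in>B. poly p b * poly (L b) y)" unfolding r_def poly_sum by simp
    finally show "poly p y = (\<Sum>b\<in>B. poly p b * poly (L b) y)" .
  qed
qed

text \<open>Expanding both arguments in the basis \<open>L\<close> expresses \<open>h\<close> through its symmetric restriction to \<open>B\<close>.\<close>

lemma symmetric_if_symmetric_on_base:
  fixes h :: "'a \<Rightarrow> 'a \<Rightarrow> 'f :: comm_ring"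
  assumes BV: "B \<subseteq> V"
    and h: "\<And>x y. x \<in> V \<Longrightarrow> y \<in> V \<Longrightarrow> h x y = (\<Sum>b\<in>B. h x b * L b y)"
    and sym: "\<And>x b. x \<in> V \<Longrightarrow> b \<in> B \<Longrightarrow> h x b = h b x"
    and xy: "x \<in> V" "y \<in> V"
  shows "h x y = h y x"
proof -
  have exp: "h x y = (\<Sum>b\<in>B. \<Sum>c\<in>B. h b c * L c x * L b y)" if "x \<in> V" "y \<in> V" for x y
  proof -
    \<comment> \<open>Only the second argument can be expanded, so \<open>x\<close> is first moved
      there by symmetry on the base.\<close>
    have "h x y = (\<Sum>b\<in>B. h b x * L b y)" using h that sym by simp
    also have "\<dots> = (\<Sum>b\<in>B. (\<Sum>c\<in>B. h b c * L c x) * L b y)"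
      using h that BV by (intro sum.cong refl) (metis subsetD)
    finally show ?thesis by (simp add: sum_distrib_right)
  qed
  have "h x y = (\<Sum>c\<in>B. \<Sum>b\<in>B. h b c * L c x * L b y)"
    unfolding exp[OF xy] by (rule sum.swap)
  also have "\<dots> = (\<Sum>c\<in>B. \<Sum>b\<in>B. h c b * L b y * L c x)"
    using sym BV by (intro sum.cong refl) (metis mult.assoc mult.commute subsetD)
  also have "\<dots> = h y x" using exp[OF xy(2,1)] by simp
  finally show ?thesis .
qed

section \<open>Linear independence of the cut functions\<close>

text \<open>If \<open>m\<close> were larger, some nontrivial combination of the antisymmetrised
  \<open>g i\<close> would vanish on all pairs meeting a \<open>k\<close>-set \<open>B\<close>,
  hence on \<open>V\<close>. By \<open>closed\<close>, function \<open>i\<close> vanishes at every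
  earlier pair, so evaluating at the pair of the least index with nonzero coefficient isolates that
  coefficient.\<close>

lemma triangular_separations_bound:
  fixes t :: "'a \<Rightarrow> real" and X S :: "nat \<Rightarrow> 'a set" and u v :: "nat \<Rightarrow> 'a"
  assumes V: "finite V" "inj_on t V" "k \<le> card V"
    and uv: "\<And>i. i < m \<Longrightarrow> u i \<in> V \<and> v i \<in> V"
    and S: "\<And>i. i < m \<Longrightarrow> S i \<subseteq> V \<and> card (S i) < k"
    and sep: "\<And>i. i < m \<Longrightarrow> u i \<in> X i \<and> v i \<notin> X i \<and> u i \<notin> S i \<and> v i \<notin> S i"
    and closed: "\<And>i j. j < i \<Longrightarrow> i < m \<Longrightarrow>
      (u j \<in> X i \<longrightarrow> v j \<in> X i \<union> S i) \<and> (v j \<in> X i \<longrightarrow> u j \<in> X i \<union> S i)"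
  shows "m \<le> (card V - k) * k + (k choose 2)"
proof (rule ccontr)
  assume large: "\<not> ?thesis"
  obtain B where B: "B \<subseteq> V" "card B = k" "finite B"
    using V by (metis obtain_subset_with_card_n finite_subset)
  \<comment> \<open>By antisymmetry one ordering of each pair inside \<open>B\<close> is enough, and
    the diagonal imposes nothing; \<open>t\<close> selects the ordering.\<close>
  define J2 where "J2 = {(b, c). b \<in> B \<and> c \<in> B \<and> t b < t c}"
  define J where "J = (V - B) \<times> B \<union> J2"
  have J2_sub: "J2 \<subseteq> B \<times> B" unfolding J2_def by auto
  have finJ: "finite J" unfolding J_def using V B finite_subset[OF J2_sub] by auto
  have "card J2 \<le> card {e. e \<subseteq> B \<and> card e = 2}"
  proof (rule card_inj_on_le[where f = "\<lambda>(b, c). {b, c}"])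
    show "inj_on (\<lambda>(b, c). {b, c}) J2"
      unfolding J2_def by (auto intro!: inj_onI simp: doubleton_eq_iff)
    show "(\<lambda>(b, c). {b, c}) ` J2 \<subseteq> {e. e \<subseteq> B \<and> card e = 2}"
      unfolding J2_def by (auto simp: card_insert_if)
  qed (use B in auto)
  then have "card J2 \<le> k choose 2" using n_subsets[OF B(3), of 2] B(2) by simp
  moreover have "card ((V - B) \<times> B) = (card V - k) * k"
    using B V by (simp add: card_cartesian_product card_Diff_subset)
  ultimately have "card J \<le> (card V - k) * k + (k choose 2)"
    unfolding J_def using card_Un_le[of "(V - B) \<times> B" J2] by linarith
  then have Jm: "card J < card {..<m}" using large by simp

  define w where "w i = (\<Prod>s\<in>S i. [:- t s, 1:])" for i
  have finS: "finite (S i)" if "i < m" for i using S[OF that] V(1) finite_subset by blast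
  have w0: "poly (w i) (t x) = 0 \<longleftrightarrow> x \<in> S i" if "i < m" "x \<in> V" for i x
    using finS[OF that(1)] S[OF that(1)] that(2) V(2)
    unfolding w_def by (auto simp: poly_prod inj_on_def)
  have degw: "degree (w i) < k" if "i < m" for i
  proof -
    have "degree (w i) \<le> (\<Sum>s\<in>S i. degree [:- t s, 1:])"
      unfolding w_def using degree_prod_sum_le[OF finS[OF that], of "\<lambda>s. [:- t s, 1:]"]
      by (simp add: o_def)
    also have "\<dots> = card (S i)" by simp
    finally show ?thesis using S[OF that] by simp
  qed
  define \<chi> where "\<chi> i x = (if x \<in> X i then 1 else 0 :: real)" for i x
  \<comment> \<open>The difference \<open>g i x y - g i y x\<close> equals
    \<open>\<chi> i x - \<chi> i y\<close> times both values of \<open>w i\<close>: it vanishes when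
    \<open>x\<close> and \<open>y\<close> lie on the same side of \<open>X i\<close> or one of them
    is in \<open>S i\<close>.\<close>
  define g where "g i x y = \<chi> i x * poly (w i) (t x) * poly (w i) (t y)" for i x y
  obtain c where c: "\<exists>i\<in>{..<m}. c i \<noteq> 0"
    "\<forall>j\<in>J. (\<Sum>i<m. c i * (case j of (x, y) \<Rightarrow> g i x y - g i y x)) = 0"
    using homogeneous_system_nontrivial[OF finJ _ Jm, of "\<lambda>i (x, y). g i x y - g i y x"] by blast
  define h where "h x y = (\<Sum>i<m. c i * g i x y)" for x y
  have hdiff: "h x y - h y x = (\<Sum>i<m. c i * (g i x y - g i y x))" for x y
    unfolding h_def by (simp add: sum_subtractf right_diff_distrib)
  have hJ: "h x y = h y x" if "(x, y) \<in> J" for x y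
    using bspec[OF c(2) that] hdiff[of x y] by simp
  have injB: "inj_on t B" using V(2) B(1) inj_on_subset by blast
  then have card_tB: "card (t ` B) = k" using B(2) card_image by metis
  obtain L where L: "\<And>p y. degree p < card (t ` B) \<Longrightarrow>
      poly p y = (\<Sum>b\<in>t ` B. poly p b * poly (L b) y)"
    using lagrange_interpolation[of "t ` B"] B(3) by blast
  have symh: "h x y = h y x" if "x \<in> V" "y \<in> V" for x y
  proof (rule symmetric_if_symmetric_on_base[OF B(1) _ _ that, where L = "\<lambda>b y. poly (L (t b)) (t y)"])
    fix x y
    \<comment> \<open>For fixed \<open>x\<close>, \<open>g i x y\<close> is a multiple of
      \<open>w i\<close> evaluated at \<open>t y\<close>, so its values on the \<open>k\<close>
      points of \<open>B\<close> determine it.\<close>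
    have "g i x y = (\<Sum>b\<in>B. g i x b * poly (L (t b)) (t y))" if "i < m" for i
      using L[of "w i" "t y"] degw[OF that] injB card_tB unfolding g_def
      by (simp add: sum.reindex sum_distrib_left mult.assoc)
    then have "h x y = (\<Sum>i<m. \<Sum>b\<in>B. c i * (g i x b * poly (L (t b)) (t y)))"
      unfolding h_def by (simp add: sum_distrib_left)
    also have "\<dots> = (\<Sum>b\<in>B. \<Sum>i<m. c i * (g i x b * poly (L (t b)) (t y)))" by (rule sum.swap)
    also have "\<dots> = (\<Sum>b\<in>B. h x b * poly (L (t b)) (t y))"
      unfolding h_def by (simp add: sum_distrib_right mult.assoc)
    finally show "h x y = (\<Sum>b\<in>B. h x b * poly (L (t b)) (t y))" .
  next
    fix x b assume xb: "x \<in> V" "b \<in> B"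
    show "h x b = h b x"
    proof (cases "x \<in> B")
      case True
      consider "t x < t b" | "t b < t x" | "x = b" using True xb(2) injB unfolding inj_on_def by force
      then show ?thesis
        using hJ[of x b] hJ[of b x] True xb(2) unfolding J_def J2_def by cases auto
    next
      case False
      then show ?thesis using hJ[of x b] xb unfolding J_def by auto
    qed
  qed

  define j where "j = (LEAST j. j < m \<and> c j \<noteq> 0)"
  have j: "j < m" "c j \<noteq> 0" using LeastI_ex[of "\<lambda>j. j < m \<and> c j \<noteq> 0"] c(1) unfolding j_def by auto
  have below: "c i = 0" if "i < j" for i
    using not_less_Least[of i "\<lambda>j. j < m \<and> c j \<noteq> 0"] that j(1) unfolding j_def by auto
  \<comment> \<open>By \<open>closed\<close>, the ends of pair \<open>j\<close> are on the same side
    of \<open>X i\<close>, or the end outside \<open>X i\<close> is a root of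
    \<open>w i\<close>.\<close>
  have above: "g i (u j) (v j) - g i (v j) (u j) = 0" if "j < i" "i < m" for i
    using closed[OF that] w0[OF that(2)] uv[OF j(1)] unfolding g_def \<chi>_def by auto
  have "0 = (\<Sum>i<m. c i * (g i (u j) (v j) - g i (v j) (u j)))"
    using symh[of "u j" "v j"] hdiff[of "u j" "v j"] uv[OF j(1)] by simp
  also have "\<dots> = (\<Sum>i<m. if i = j then c j * (g j (u j) (v j) - g j (v j) (u j)) else 0)"
    using below above by (intro sum.cong refl) (metis lessThan_iff linorder_cases mult_zero_left mult_zero_right)
  also have "\<dots> = c j * (g j (u j) (v j) - g j (v j) (u j))" using j(1) by simp
  \<comment> \<open>Pair \<open>j\<close> is split by its own \<open>X j\<close>, and neither end is
    a root of \<open>w j\<close>.\<close>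
  also have "\<dots> \<noteq> 0" using j sep[OF j(1)] w0[OF j(1)] uv[OF j(1)] unfolding g_def \<chi>_def by simp
  finally show False by simp
qed

section \<open>Cuts along the edge ordering and the final count\<close>

theorem theorem6:
  fixes V :: "'a set" and E :: "'a set set" and k :: nat
  assumes "k \<ge> 1"
    and "simple_graph V E"
    and "k_constructible k V E"
    and "card V \<ge> k + 1"
  shows "card E \<le> card V * k - ((k + 1) choose 2)"
proof -
  obtain es where es: "distinct es" "set es = E"
    and con: "\<And>i u v P. i < length es \<Longrightarrow> es ! i = {u, v} \<Longrightarrow>
      disjoint_paths (set (take i es)) u v P \<Longrightarrow> card P \<le> k - 1"
    using assms(3) unfolding k_constructible_def by blast
  have V: "finite V" and E: "\<And>e. e \<in> E \<Longrightarrow> \<exists>u v. e = {u, v} \<and> u \<noteq> v \<and> u \<in> V \<and> v \<in> V"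
    using assms(2) unfolding simple_graph_def by auto
  obtain f :: "'a \<Rightarrow> nat" where f: "inj_on f V"
    using V finite_imp_inj_to_nat_seg by metis
  define t where "t x = real (f x)" for x
  have t: "inj_on t V" using f unfolding t_def inj_on_def by simp
  have "\<exists>u v X S. es ! i = {u, v} \<and> u \<in> V \<and> v \<in> V \<and> S \<subseteq> V \<and> card S < k \<and>
      u \<in> X \<and> v \<notin> X \<and> u \<notin> S \<and> v \<notin> S \<and>
      (\<forall>j<i. \<forall>x y. es ! j = {x, y} \<longrightarrow> x \<in> X \<longrightarrow> y \<in> X \<union> S)"
    if i: "i < length es" for i
  proof -
    let ?F = "set (take i es)"
    have FE: "?F \<subseteq> E" using es(2) set_take_subset by metis
    have "es ! i \<in> E" using i es(2) nth_mem by blast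
    then obtain u v where uv: "es ! i = {u, v}" "u \<noteq> v" "u \<in> V" "v \<in> V" using E by blast
    \<comment> \<open>Distinctness of \<open>es\<close> makes the new edge absent so far, which
      gives the nonadjacency that the vertex cut requires.\<close>
    have nF: "{u, v} \<notin> ?F"
    proof
      assume "{u, v} \<in> ?F"
      then obtain j where "j < i" "es ! j = es ! i"
        using uv(1) by (auto simp: in_set_conv_nth)
      then show False using es(1) i nth_eq_iff_index_eq[of es j i] by simp
    qed
    have dbl: "\<exists>x y. e = {x, y} \<and> x \<noteq> y" if "e \<in> ?F" for e using E FE that by blast
    have cP: "card P \<noteq> k" if "disjoint_paths ?F u v P" for P
      using con[OF i uv(1) that] assms(1) by linarith
    obtain X S where XS: "finite S" "card S < k" "u \<in> X" "v \<notin> X" "u \<notin> S" "v \<notin> S"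
      and cl: "\<And>x y. {x, y} \<in> ?F \<Longrightarrow> x \<in> X \<Longrightarrow> y \<in> X \<union> S"
      using small_vertex_cut[OF _ dbl uv(2) nF cP] by (metis finite_set)
    \<comment> \<open>The cut may contain points outside \<open>V\<close>; intersecting with
      \<open>V\<close> loses nothing because edges end in \<open>V\<close>.\<close>
    have "y \<in> X \<union> (S \<inter> V)" if "j < i" "es ! j = {x, y}" "x \<in> X" for j x y
    proof -
      have "{x, y} \<in> ?F" using that(1,2) i by (metis in_set_conv_nth length_take min.absorb4 nth_take)
      moreover from this have "y \<in> V" using FE E by (metis doubleton_eq_iff subsetD)
      ultimately show ?thesis using cl that(3) by blast
    qed
    then have "\<forall>j<i. \<forall>x y. es ! j = {x, y} \<longrightarrow> x \<in> X \<longrightarrow> y \<in> X \<union> (S \<inter> V)" by metis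
    moreover have "card (S \<inter> V) < k" using XS(1,2) card_mono[of S "S \<inter> V"] by auto
    ultimately show ?thesis using uv XS
      by (intro exI[of _ u] exI[of _ v] exI[of _ X] exI[of _ "S \<inter> V"]) simp
  qed
  then obtain u v X S where *: "\<And>i. i < length es \<Longrightarrow>
      es ! i = {u i, v i} \<and> u i \<in> V \<and> v i \<in> V \<and> S i \<subseteq> V \<and> card (S i) < k \<and>
      u i \<in> X i \<and> v i \<notin> X i \<and> u i \<notin> S i \<and> v i \<notin> S i \<and>
      (\<forall>j<i. \<forall>x y. es ! j = {x, y} \<longrightarrow> x \<in> X i \<longrightarrow> y \<in> X i \<union> S i)"
    by metis
  have "length es \<le> (card V - k) * k + (k choose 2)"
  proof (rule triangular_separations_bound[OF V t, of k _ u v S X])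
    fix i j assume ji: "j < i" "i < length es"
    \<comment> \<open>Both readings of the unordered edge are needed, one for each
      implication.\<close>
    then have "es ! j = {u j, v j}" "es ! j = {v j, u j}" using *[of j] by auto
    then show "(u j \<in> X i \<longrightarrow> v j \<in> X i \<union> S i) \<and> (v j \<in> X i \<longrightarrow> u j \<in> X i \<union> S i)"
      using *[OF ji(2)] ji(1) by blast
  qed (use assms(4) * in auto)
  moreover have "(card V - k) * k + (k choose 2) = card V * k - ((k + 1) choose 2)"
  proof -
    obtain d where d: "card V = k + d" using assms(4) by (metis add_leD1 le_Suc_ex)
    \<comment> \<open>With \<open>card V = k + d\<close> both sides equal
      \<open>d * k + (k choose 2)\<close>, so the truncated subtraction is exact.\<close>
    have "(k + 1 choose 2) + (k choose 2) = k * k"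
      by (induction k) (auto simp: numeral_2_eq_2)
    then show ?thesis using d by (simp add: algebra_simps)
  qed
  ultimately show ?thesis using distinct_card[OF es(1)] es(2) by simp
qed

end
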